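(* Let $h>0$. Let $b:\mathbb{R}^d\to\mathbb{R}^d$ be continuous and assume: (L1) there is $C>0$ such that $|b(x)|\leqslant C(1+|x|)$ for all $x\in\mathbb{R}^d$; (L2) there are $\tilde\beta\in\mathbb{R}$ and $\tilde\alpha>0$ such that $\langle x,b(x)\rangle\leqslant\tilde\beta-\tilde\alpha|x|^2$ for all $x\in\mathbb{R}^d$. Let $\sigma:\mathbb{R}^d\to\mathcal{M}_d(\mathbb{R})$ be a continuous and bounded function such that $\sigma(x)$ is invertible for all $x$ and $x\mapsto\sigma^{-1}(x)$ is continuous. Let $F_h(x,w)=x+hb(x)+\sigma(x)w$ for $(x,w)\in\mathbb{R}^d\times\mathbb{R}^d$. Then the hypotheses $(\mathbf{H_1})$ and $(\mathbf{H_2})$ stated in the context hold for $F=F_h$ as soon as $$0<h<\min\left\{\sqrt{1+\frac{\tilde\alpha}{2C^2}}-1,\ \frac1{\tilde\alpha}\right\},$$ where $\tilde\alpha$ and $C$ are given by (L1) and (L2).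
   Context: $\mathcal{X}:=\mathbb{R}^d$; $|\cdot|$ is the Euclidean norm, $\langle\cdot,\cdot\rangle$ the Euclidean scalar product, $\mathcal{M}_d(\mathbb{R})$ the set of real $d\times d$ matrices, $\sigma^{-1}(x)$ the inverse matrix of $\sigma(x)$, $B(0,K)$ the closed ball of radius $K$ centered at $0$, $J_f(u)$ the Jacobian matrix of $f$ at $u$. For a continuous function $F:\mathcal{X}\times\mathbb{R}^d\to\mathcal{X}$: Hypothesis $(\mathbf{H_1})$: there exist a continuous function $V:\mathcal{X}\to(0,+\infty)$ with $\lim_{|x|\to+\infty}V(x)=+\infty$, $\gamma\in(0,1)$ and a constant $C'>0$ such that $V(F(x,w))\le\gamma V(x)+C'(1+|w|)$ for all $(x,w)\in\mathcal{X}\times\mathbb{R}^d$. Hypothesis $(\mathbf{H_2})$: put $\tilde F(x,u,y):=F(x,u+y)$. For every $K>0$ there exist $\tilde K>0$, $C_{\tilde K}>0$ and $M_K>0$ such that for every $\mathbf{x}=(x,x',y,y')\in B(0,K)^4$ there exists $\Lambda_{\mathbf{x}}:\mathbb{R}^d\to\mathbb{R}^d$ such that: (a) $\Lambda_{\mathbf{x}}$ is a bijection of $\mathbb{R}^d$ onto $\mathbb{R}^d$, and is a $\mathcal{C}^1$-diffeomorphism between two open sets $U$ and $D$ such that $\mathbb{R}^d\setminus U$ and $\mathbb{R}^d\setminus D$ are negligible; (b) for all $u\in B(0,\tilde K)$, $\tilde F(x,u,y)=\tilde F(x',\Lambda_{\mathbf{x}}(u),y')$ and $|\det(J_{\Lambda_{\mathbf{x}}}(u))|\ge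 C_{\tilde K}$; (c) for all $u\in\mathbb{R}^d$, $|\Lambda_{\mathbf{x}}(u)-u|\le M_K$. *)

theory Defs
  imports "HOL-Analysis.Analysis"
begin

(* Intended for open S only: on such S, differentiability within S and at the point agree. *)
definition C1_on :: "(real^'n) set \<Rightarrow> (real^'n \<Rightarrow> real^'m) \<Rightarrow> bool" where
  "C1_on S f \<longleftrightarrow> f differentiable_on S \<and> continuous_on S (\<lambda>x. jacobian f (at x))"

definition C1_diffeomorphism ::
    "(real^'n) set \<Rightarrow> (real^'n) set \<Rightarrow> (real^'n \<Rightarrow> real^'n) \<Rightarrow> bool" where
  "C1_diffeomorphism U D f \<longleftrightarrow>
     open U \<and> open D \<and> bij_betw f U D \<and> C1_on U f \<and> C1_on D (inv_into U f)"

definition hyp_H1 :: "((real^'d) \<times> (real^'d) \<Rightarrow> real^'d) \<Rightarrow> bool" where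
  "hyp_H1 F \<longleftrightarrow>
     (\<exists>(V :: real^'d \<Rightarrow> real) (\<gamma> :: real) (C' :: real).
        continuous_on UNIV V \<and> (\<forall>x. V x > 0) \<and> filterlim V at_top at_infinity \<and>
        0 < \<gamma> \<and> \<gamma> < 1 \<and> C' > 0 \<and>
        (\<forall>x w. V (F (x, w)) \<le> \<gamma> * V x + C' * (1 + norm w)))"

definition tilde :: "((real^'d) \<times> (real^'d) \<Rightarrow> real^'d) \<Rightarrow>
    real^'d \<Rightarrow> real^'d \<Rightarrow> real^'d \<Rightarrow> real^'d" where
  "tilde F x u y = F (x, u + y)"

(* In (b), the existence of the Jacobian matrix at u is part of the assertion: it is stated
   explicitly because the ball need not be contained in U and jacobian is a total function. *)
definition hyp_H2 :: "((real^'d) \<times> (real^'d) \<Rightarrow> real^'d) \<Rightarrow> bool" where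
  "hyp_H2 F \<longleftrightarrow>
     (\<forall>K>0. \<exists>Kt>0. \<exists>CK>0. \<exists>MK>0.
        \<forall>x\<in>cball 0 K. \<forall>x'\<in>cball 0 K. \<forall>y\<in>cball 0 K. \<forall>y'\<in>cball 0 K.
        \<exists>\<Lambda> :: real^'d \<Rightarrow> real^'d.
          bij \<Lambda> \<and>
          (\<exists>U D. C1_diffeomorphism U D \<Lambda> \<and> negligible (- U) \<and> negligible (- D)) \<and>
          (\<forall>u\<in>cball 0 Kt.
             tilde F x u y = tilde F x' (\<Lambda> u) y' \<and>
             \<Lambda> differentiable (at u) \<and> \<bar>det (jacobian \<Lambda> (at u))\<bar> \<ge> CK) \<and>
          (\<forall>u. norm (\<Lambda> u - u) \<le> MK))"

definition F_h :: "real \<Rightarrow> (real^'d \<Rightarrow> real^'d) \<Rightarrow> (real^'d \<Rightarrow> real^'d^'d) \<Rightarrow>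
    (real^'d) \<times> (real^'d) \<Rightarrow> real^'d" where
  "F_h h b \<sigma> = (\<lambda>(x, w). x + h *\<^sub>R b x + \<sigma> x *v w)"

end

theory Submission
  imports Defs
begin

text \<open>The drift condition holds for \<open>V x = 1 + |x|\<close>: expanding \<open>|x + h b x|\<^sup>2\<close> with (L1) and (L2),
  the step-size condition makes its leading coefficient at most \<open>1 - h \<alpha>\<close>, which lies in \<open>(0, 1)\<close>.
  For the coupling, the required equality on a ball forces \<open>\<Lambda>\<close> to be the affine map
  \<open>u \<mapsto> \<sigma>(x')\<^sup>-\<^sup>1 \<sigma>(x) u + c\<close> there. Since \<open>\<Lambda>\<close> need not be continuous, it can be obtained from
  exchanges of disjoint convex sets along affine bijections, which move every point by a bounded
  amount and are smooth off the (negligible) frontiers. All bounds are uniform by compactness.\<close>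

section \<open>Continuity of matrix products and determinants; inverse matrices\<close>

lemma bounded_bilinear_matrix_vector_mult:
  "bounded_bilinear ((*v) :: real^'n^'m \<Rightarrow> real^'n \<Rightarrow> real^'m)"
  unfolding bilinear_conv_bounded_bilinear[symmetric] bilinear_def
  by (auto intro!: linearI simp: matrix_vector_mult_add_rdistrib matrix_vector_right_distrib
      scaleR_matrix_vector_assoc matrix_vector_mult_scaleR)

lemma bounded_bilinear_matrix_matrix_mult:
  "bounded_bilinear ((**) :: real^'n^'m \<Rightarrow> real^'k^'n \<Rightarrow> real^'k^'m)"
  unfolding bilinear_conv_bounded_bilinear[symmetric] bilinear_def
  by (auto intro!: linearI simp: matrix_matrix_mult_def vec_eq_iff algebra_simps sum.distrib sum_distrib_left)

lemmas continuous_on_matrix_vector_mult =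
  bounded_bilinear.continuous_on[OF bounded_bilinear_matrix_vector_mult]

lemmas continuous_on_matrix_matrix_mult =
  bounded_bilinear.continuous_on[OF bounded_bilinear_matrix_matrix_mult]

lemma continuous_on_det:
  fixes f :: "'a::topological_space \<Rightarrow> real^'n^'n"
  assumes "continuous_on S f"
  shows "continuous_on S (\<lambda>x. det (f x))"
  unfolding det_def by (intro continuous_intros assms)

lemma matrix_inv_cancel:
  fixes A :: "real^'n^'n"
  assumes "invertible A"
  shows "A *v (matrix_inv A *v u) = u" "matrix_inv A *v (A *v u) = u"
    "invertible (matrix_inv A)"
proof -
  have *: "A ** matrix_inv A = mat 1 \<and> matrix_inv A ** A = mat 1"
    using assms unfolding invertible_def matrix_inv_def by (rule someI_ex)
  show "A *v (matrix_inv A *v u) = u" "matrix_inv A *v (A *v u) = u"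
    using * by (simp_all add: matrix_vector_mul_assoc)
  show "invertible (matrix_inv A)"
    using * unfolding invertible_def by blast
qed

section \<open>Jacobians and C1 maps on open sets\<close>

lemma jacobian_eq:
  assumes "(f has_derivative f') (at x)"
  shows "jacobian f (at x) = matrix f'"
  using frechet_derivative_at[OF assms] by (simp add: jacobian_def)

lemma jacobian_transform_open:
  fixes f g :: "real^'n \<Rightarrow> real^'m"
  assumes "open S" "x \<in> S" "\<And>x. x \<in> S \<Longrightarrow> f x = g x" "f differentiable (at x)"
  shows "g differentiable (at x)" "jacobian g (at x) = jacobian f (at x)"
proof -
  obtain f' where f': "(f has_derivative f') (at x)"
    using assms(4) by (auto simp: differentiable_def)
  have g': "(g has_derivative f') (at x)"
    by (rule has_derivative_transform_within_open[OF f' assms(1,2)]) (use assms(3) in auto)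
  show "g differentiable (at x)" using g' by (auto simp: differentiable_def)
  show "jacobian g (at x) = jacobian f (at x)"
    using jacobian_eq[OF f'] jacobian_eq[OF g'] by simp
qed

lemma C1_on_open:
  "open S \<Longrightarrow> C1_on S f \<longleftrightarrow>
    (\<forall>x\<in>S. f differentiable (at x)) \<and> continuous_on S (\<lambda>x. jacobian f (at x))"
  by (simp add: C1_on_def differentiable_on_eq_differentiable_at)

text \<open>Derivatives are local, so equality on an open set suffices. This lets piecewise maps and
  \<open>inv_into\<close> inherit regularity from an explicit formula.\<close>

lemma C1_on_cong:
  assumes "open S" "C1_on S f" "\<And>x. x \<in> S \<Longrightarrow> f x = g x"
  shows "C1_on S g"
proof -
  have d: "\<And>x. x \<in> S \<Longrightarrow> f differentiable (at x)"
    and c: "continuous_on S (\<lambda>x. jacobian f (at x))"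
    using assms(1,2) by (auto simp: C1_on_open)
  note J = jacobian_transform_open[of S _ f g, OF assms(1) _ assms(3) d]
  have "continuous_on S (\<lambda>x. jacobian g (at x))"
    using c by (rule continuous_on_eq) (simp add: J)
  then show ?thesis using assms(1) J(1) by (simp add: C1_on_open)
qed

lemma C1_on_Un:
  assumes "open S" "open T" "C1_on S f" "C1_on T f"
  shows "C1_on (S \<union> T) f"
  using assms by (auto simp: C1_on_open open_Un intro!: continuous_on_open_Un)

lemma C1_on_subset: "C1_on S f \<Longrightarrow> T \<subseteq> S \<Longrightarrow> C1_on T f"
  by (auto simp: C1_on_def intro: differentiable_on_subset continuous_on_subset)

text \<open>By the chain rule the Jacobian of the composition is the product of the two Jacobians,
  and matrix multiplication, being bilinear, is continuous.\<close>

lemma C1_on_compose: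
  assumes "open S" "open T" "C1_on S f" "C1_on T g" "f ` S \<subseteq> T"
  shows "C1_on S (g \<circ> f)"
proof -
  have f: "(f has_derivative (\<lambda>h. jacobian f (at x) *v h)) (at x)" if "x \<in> S" for x
    using assms(1,3) that by (simp add: C1_on_open jacobian_works)
  have g: "(g has_derivative (\<lambda>h. jacobian g (at y) *v h)) (at y)" if "y \<in> T" for y
    using assms(2,4) that by (simp add: C1_on_open jacobian_works)
  have gf: "((g \<circ> f) has_derivative
      (\<lambda>h. (jacobian g (at (f x)) ** jacobian f (at x)) *v h)) (at x)" if "x \<in> S" for x
    using diff_chain_at[OF f[OF that] g[of "f x"]] assms(5) that
    by (auto simp: o_def matrix_vector_mul_assoc)
  have "continuous_on S f"
    using f by (meson continuous_at_imp_continuous_on has_derivative_continuous)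
  then have "continuous_on S (\<lambda>x. jacobian g (at (f x)) ** jacobian f (at x))"
    using assms
    by (intro continuous_on_matrix_matrix_mult continuous_on_compose2[of T "\<lambda>y. jacobian g (at y)" S f])
      (auto simp: C1_on_open)
  then have "continuous_on S (\<lambda>x. jacobian (g \<circ> f) (at x))"
    by (rule continuous_on_eq) (simp add: jacobian_eq[OF gf])
  moreover have "\<forall>x\<in>S. (g \<circ> f) differentiable (at x)"
    using gf unfolding differentiable_def by blast
  ultimately show ?thesis
    by (simp only: C1_on_open[OF assms(1)])
qed

lemma has_derivative_affine:
  "((\<lambda>u. A *v u + c) has_derivative (\<lambda>h. A *v h)) (at x)" for A :: "real^'n^'m"
  by (intro has_derivative_add_const bounded_linear_imp_has_derivative matrix_vector_mul_bounded_linear)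

lemma C1_on_affine: "open S \<Longrightarrow> C1_on S (\<lambda>u. A *v u + c)" for A :: "real^'n^'m"
  using has_derivative_affine[of A c]
  by (auto simp: C1_on_open jacobian_eq[OF has_derivative_affine] differentiable_def)

lemma C1_on_id: "open S \<Longrightarrow> C1_on S (\<lambda>u :: real^'n. u)"
  using C1_on_affine[of S "mat 1" 0] by simp

section \<open>C1 diffeomorphisms\<close>

text \<open>An explicit inverse \<open>g\<close> agrees with \<open>inv_into U f\<close> on the open
  set \<open>D\<close>, so its regularity carries over.\<close>

lemma C1_diffeomorphismI:
  assumes "open U" "open D" "f ` U \<subseteq> D" "g ` D \<subseteq> U"
    and "\<And>x. x \<in> U \<Longrightarrow> g (f x) = x" "\<And>y. y \<in> D \<Longrightarrow> f (g y) = y"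
    and "C1_on U f" "C1_on D g"
  shows "C1_diffeomorphism U D f"
proof -
  have bij: "bij_betw f U D"
    by (rule bij_betw_byWitness[where f' = g]) (use assms in auto)
  have "g y = inv_into U f y" if "y \<in> D" for y
    using that assms bij by (metis bij_betw_inv_into_left image_subset_iff)
  then have "C1_on D (inv_into U f)"
    using C1_on_cong[OF assms(2,8)] by blast
  then show ?thesis using assms bij by (simp add: C1_diffeomorphism_def)
qed

lemma C1_diffeomorphism_affine:
  fixes A :: "real^'n^'n"
  assumes "invertible A" "open P"
  shows "C1_diffeomorphism P ((\<lambda>u. A *v u + c) ` P) (\<lambda>u. A *v u + c)"
proof (rule C1_diffeomorphismI)
  let ?T = "\<lambda>u. A *v u + c"
  let ?S = "\<lambda>y. matrix_inv A *v y + - (matrix_inv A *v c)"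
  have TS: "?T (?S y) = y" and ST: "?S (?T u) = u" for y u
    using assms(1) by (simp_all add: matrix_vector_right_distrib matrix_inv_cancel
        matrix_vector_mult_diff_distrib)
  \<comment> \<open>As a preimage under the continuous inverse, the image of \<open>P\<close> is
    open.\<close>
  have "?T ` P = ?S -` P"
  proof (intro set_eqI iffI)
    show "y \<in> ?S -` P" if "y \<in> ?T ` P" for y
      using that ST by (auto simp del: add_uminus_conv_diff)
    show "y \<in> ?T ` P" if "y \<in> ?S -` P" for y
      using that TS[of y] by (intro image_eqI[of y ?T "?S y"]) auto
  qed
  moreover have "open (?S -` P)"
    by (intro open_vimage assms continuous_intros
        matrix_vector_mult_linear_continuous_on)
  ultimately show op: "open (?T ` P)" by simp
  show "?S ` ?T ` P \<subseteq> P" "\<And>x. ?S (?T x) = x" "\<And>y. ?T (?S y) = y"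
    using TS ST by (auto simp del: add_uminus_conv_diff)
  show "C1_on P ?T" "C1_on (?T ` P) ?S"
    using assms op by (auto intro: C1_on_affine simp del: add_uminus_conv_diff)
qed (use assms in auto)

section \<open>Bijections that are diffeomorphisms off negligible sets\<close>

text \<open>Clause (a) of the second hypothesis, isolated because it is stable under composition. On
  the negligible set \<open>- U\<close> nothing is asked beyond global bijectivity.\<close>

definition almost_C1_diffeomorphism :: "(real^'n \<Rightarrow> real^'n) \<Rightarrow> bool" where
  "almost_C1_diffeomorphism f \<longleftrightarrow>
    bij f \<and> (\<exists>U D. C1_diffeomorphism U D f \<and> negligible (- U) \<and> negligible (- D))"

lemma negligible_C1_image:
  fixes f :: "real^'n \<Rightarrow> real^'n"
  assumes "C1_on S f" "N \<subseteq> S" "negligible N"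
  shows "negligible (f ` N)"
  using assms
  by (intro negligible_differentiable_image_negligible)
    (auto simp: C1_on_def intro: differentiable_on_subset)

lemma almost_C1_diffeomorphism_compose:
  assumes "almost_C1_diffeomorphism f" "almost_C1_diffeomorphism g"
  shows "almost_C1_diffeomorphism (g \<circ> f)"
proof -
  obtain U D where UD: "C1_diffeomorphism U D f" "negligible (- U)" "negligible (- D)"
    using assms(1) by (auto simp: almost_C1_diffeomorphism_def)
  obtain V E where VE: "C1_diffeomorphism V E g" "negligible (- V)" "negligible (- E)"
    using assms(2) by (auto simp: almost_C1_diffeomorphism_def)
  have bij: "bij f" "bij g"
    using assms by (auto simp: almost_C1_diffeomorphism_def)
  define f' where "f' = inv_into U f"
  define g' where "g' = inv_into V g"
  have o: "open U" "open D" "open V" "open E"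
    and bb: "bij_betw f U D" "bij_betw g V E"
    and c: "C1_on U f" "C1_on D f'" "C1_on V g" "C1_on E g'"
    using UD(1) VE(1) by (auto simp: C1_diffeomorphism_def f'_def g'_def)
  have f': "f' (f x) = x" "f x \<in> D" if "x \<in> U" for x
    using bb(1) that by (auto simp: f'_def bij_betw_inv_into_left bij_betw_apply)
  have f'': "f (f' y) = y" "f' y \<in> U" if "y \<in> D" for y
    using bb(1) that unfolding f'_def
    by (auto simp: bij_betw_inv_into_right intro: bij_betw_apply[OF bij_betw_inv_into])
  have g': "g' (g x) = x" "g x \<in> E" if "x \<in> V" for x
    using bb(2) that by (auto simp: g'_def bij_betw_inv_into_left bij_betw_apply)
  have g'': "g (g' y) = y" "g' y \<in> V" if "y \<in> E" for y
    using bb(2) that unfolding g'_def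
    by (auto simp: bij_betw_inv_into_right intro: bij_betw_apply[OF bij_betw_inv_into])
  have cont: "continuous_on U f" "continuous_on E g'"
    using c by (auto simp: C1_on_def differentiable_imp_continuous_on)
  \<comment> \<open>These are the points where both maps, or both inverses, are regular. The points
    of \<open>U\<close> and \<open>E\<close> lost here form the images of \<open>D - V\<close> under
    \<open>f'\<close> and of \<open>V - D\<close> under \<open>g\<close>, which are C1 images of
    null sets and hence null.\<close>
  let ?U = "U \<inter> f -` V" and ?E = "E \<inter> g' -` D"
  have oU: "open ?U" and oE: "open ?E"
    using cont o by (auto intro: continuous_open_preimage)
  have "C1_diffeomorphism ?U ?E (g \<circ> f)"
  proof (rule C1_diffeomorphismI[where g = "f' \<circ> g'"])
    show "C1_on ?U (g \<circ> f)"
      by (rule C1_on_compose[OF oU o(3) C1_on_subset[OF c(1)] c(3)]) auto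
    show "C1_on ?E (f' \<circ> g')"
      by (rule C1_on_compose[OF oE o(2) C1_on_subset[OF c(4)] c(2)]) auto
  qed (use oU oE f' f'' g' g'' in auto)
  moreover have "negligible (- ?U)"
  proof -
    have "x \<in> - U \<union> f' ` (D - V)" if "x \<in> - ?U" for x
      using that f'[of x] by (auto simp: image_iff) (metis Diff_iff)
    then have "- ?U \<subseteq> - U \<union> f' ` (D - V)" by blast
    moreover have "negligible (f' ` (D - V))"
      by (rule negligible_C1_image[OF c(2)]) (auto intro: negligible_subset[OF VE(2)])
    ultimately show ?thesis
      by (meson UD(2) negligible_Un negligible_subset)
  qed
  moreover have "negligible (- ?E)"
  proof -
    have "x \<in> - E \<union> g ` (V - D)" if "x \<in> - ?E" for x
      using that g''[of x] by (auto simp: image_iff) (metis Diff_iff)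
    then have "- ?E \<subseteq> - E \<union> g ` (V - D)" by blast
    moreover have "negligible (g ` (V - D))"
      by (rule negligible_C1_image[OF c(3)]) (auto intro: negligible_subset[OF UD(3)])
    ultimately show ?thesis
      by (meson VE(3) negligible_Un negligible_subset)
  qed
  ultimately show ?thesis
    using bij bij_comp unfolding almost_C1_diffeomorphism_def by blast
qed

section \<open>Exchanges of disjoint sets and extension of affine maps\<close>

text \<open>Intended for disjoint \<open>P\<close>, \<open>Q\<close> and a bijection
  \<open>T\<close> of \<open>P\<close> onto \<open>Q\<close>. It is then an involution, so
  bijectivity on the whole space holds whatever happens at the frontiers.\<close>

definition swap_along ::
    "(real^'n) set \<Rightarrow> (real^'n) set \<Rightarrow> (real^'n \<Rightarrow> real^'n) \<Rightarrow> real^'n \<Rightarrow> real^'n" where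
  "swap_along P Q T u = (if u \<in> P then T u else if u \<in> Q then inv_into P T u else u)"

text \<open>The map is \<open>T\<close>, its inverse or the identity on three open pieces:
  \<open>P\<close>, \<open>Q\<close> and the exterior of their union. It preserves the union of
  these pieces and is its own inverse there; the remaining points lie on the two frontiers.\<close>

lemma almost_C1_diffeomorphism_swap_along:
  assumes T: "C1_diffeomorphism P Q T" and disj: "P \<inter> Q = {}"
    and negl: "negligible (frontier P)" "negligible (frontier Q)"
  shows "almost_C1_diffeomorphism (swap_along P Q T)"
proof -
  let ?f = "swap_along P Q T"
  let ?W = "- closure (P \<union> Q)"
  let ?U = "P \<union> Q \<union> ?W"
  have o: "open P" "open Q" and bb: "bij_betw T P Q"
    and c: "C1_on P T" "C1_on Q (inv_into P T)"
    using T by (auto simp: C1_diffeomorphism_def)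
  have TP: "T u \<in> Q" "inv_into P T (T u) = u" if "u \<in> P" for u
    using bb that by (auto simp: bij_betw_inv_into_left bij_betw_apply)
  have TQ: "inv_into P T u \<in> P" "T (inv_into P T u) = u" if "u \<in> Q" for u
    using bb that
    by (auto simp: bij_betw_inv_into_right intro: bij_betw_apply[OF bij_betw_inv_into])
  have inv: "?f (?f u) = u" for u
    using TP TQ disj by (auto simp: swap_along_def)
  have W: "u \<notin> P" "u \<notin> Q" if "u \<in> ?W" for u
    using that closure_subset[of "P \<union> Q"] by auto
  have "C1_on P ?f"
    by (rule C1_on_cong[OF o(1) c(1)]) (simp add: swap_along_def)
  moreover have "C1_on Q ?f"
    by (rule C1_on_cong[OF o(2) c(2)]) (use disj in \<open>auto simp: swap_along_def\<close>)
  moreover have "C1_on ?W ?f"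
    by (rule C1_on_cong[OF _ C1_on_id]) (use W in \<open>auto simp: swap_along_def\<close>)
  ultimately have C1: "C1_on ?U ?f"
    using o by (intro C1_on_Un) auto
  have "?f ` ?U \<subseteq> ?U"
    using TP TQ W by (auto simp: swap_along_def)
  then have "C1_diffeomorphism ?U ?U ?f"
    using o inv C1 by (intro C1_diffeomorphismI[where g = ?f]) auto
  moreover have "negligible (- ?U)"
    by (rule negligible_subset[OF negligible_Un[OF negl]])
      (use o in \<open>auto simp: frontier_def interior_open\<close>)
  moreover have "bij ?f"
    using inv by (metis involuntory_imp_bij)
  ultimately show ?thesis unfolding almost_C1_diffeomorphism_def by blast
qed

text \<open>A point of \<open>Q\<close> moves back exactly as far as its preimage in
  \<open>P\<close> moves forward.\<close>

lemma norm_swap_along_diff_le: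
  assumes "bij_betw T P Q" "\<And>p. p \<in> P \<Longrightarrow> norm (T p - p) \<le> m" "0 \<le> m"
  shows "norm (swap_along P Q T u - u) \<le> m"
proof -
  have "norm (inv_into P T u - u) \<le> m" if "u \<in> Q"
    using assms(2)[of "inv_into P T u"] that assms(1)
    by (simp add: norm_minus_commute bij_betw_inv_into_right
        bij_betw_apply[OF bij_betw_inv_into[OF assms(1)]])
  then show ?thesis using assms by (simp add: swap_along_def)
qed

text \<open>The ball and its image may overlap, so the ball is first swapped with a distant translate
  of itself, which is then swapped with the image.\<close>

lemma affine_extension_almost_C1_diffeomorphism:
  fixes A :: "real^'n^'n"
  assumes A: "invertible A" and r: "0 < r" "r \<le> R"
    and R: "\<And>u. u \<in> ball 0 r \<Longrightarrow> norm (A *v u + c) \<le> R"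
  obtains \<Lambda> where "almost_C1_diffeomorphism \<Lambda>"
    "\<And>u. u \<in> ball 0 r \<Longrightarrow> \<Lambda> u = A *v u + c"
    "\<And>u. norm (\<Lambda> u - u) \<le> 8 * R"
proof -
  \<comment> \<open>As \<open>r \<le> R\<close>, the translate of the ball by \<open>v\<close> lies
    strictly between the radii \<open>2 * R\<close> and \<open>4 * R\<close>, away from the ball and
    from its affine image, both of which lie within radius \<open>R\<close>.\<close>
  obtain v :: "real^'n" where v: "norm v = 3 * R"
    using vector_choose_size[of "3 * R"] r by auto
  define T1 where "T1 = (\<lambda>u. mat 1 *v u + v)"
  \<comment> \<open>Chosen so that \<open>T2 (T1 u) = A *v u + c\<close>.\<close>
  define T2 where "T2 = (\<lambda>u. A *v u + (c - A *v v))"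
  have T1: "T1 u = u + v" for u by (simp add: T1_def)
  have T2: "T2 u = A *v (u - v) + c" for u
    by (simp add: T2_def matrix_vector_mult_diff_distrib)
  define P where "P = ball (0 :: real^'n) r"
  define P' where "P' = T1 ` P"
  define Q where "Q = T2 ` P'"
  have P': "norm (p - v) < r" if "p \<in> P'" for p
    using that by (auto simp: P'_def P_def T1)
  have nP': "2 * R < norm p" "norm p < 4 * R" if "p \<in> P'" for p
    using P'[OF that] v r norm_triangle_ineq2[of v p] norm_triangle_ineq2[of p v]
    by (auto simp: norm_minus_commute)
  have nT2: "norm (T2 p) \<le> R" if "p \<in> P'" for p
    using R[of "p - v"] P'[OF that] by (simp add: T2)
  have "invertible (mat 1 :: real^'n^'n)"
    unfolding invertible_def by (rule exI[of _ "mat 1"]) simp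
  then have d1: "C1_diffeomorphism P P' T1"
    unfolding P'_def T1_def by (rule C1_diffeomorphism_affine) (simp add: P_def)
  then have "open P'" by (simp add: C1_diffeomorphism_def)
  then have d2: "C1_diffeomorphism P' Q T2"
    unfolding Q_def T2_def by (intro C1_diffeomorphism_affine A)
  \<comment> \<open>Convexity passes to affine images and makes all three frontiers
    negligible.\<close>
  have "convex P" by (simp add: P_def)
  then have "convex P'"
    using convex_translation[of P v] by (simp add: P'_def T1_def add.commute)
  have "Q = (\<lambda>u. (c - A *v v) + u) ` ((*v) A ` P')"
    unfolding Q_def T2_def image_image by (simp add: add.commute)
  then have "convex Q"
    using \<open>convex P'\<close> by (simp only:) (intro convex_translation convex_linear_image matrix_vector_mul_linear)
  have disj1: "P \<inter> P' = {}"
    using nP'(1) r by (fastforce simp: P_def)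
  have disj2: "P' \<inter> Q = {}"
    using nP'(1) nT2 r by (fastforce simp: Q_def)
  define f where "f = swap_along P P' T1"
  define g where "g = swap_along P' Q T2"
  have "almost_C1_diffeomorphism (g \<circ> f)"
    unfolding f_def g_def
    by (intro almost_C1_diffeomorphism_compose almost_C1_diffeomorphism_swap_along d1 d2
        disj1 disj2 negligible_convex_frontier \<open>convex P\<close> \<open>convex P'\<close> \<open>convex Q\<close>)
  moreover have "(g \<circ> f) u = A *v u + c" if "u \<in> ball 0 r" for u
  proof -
    have "u \<in> P" "T1 u \<in> P'" using that by (auto simp: P_def P'_def)
    then show ?thesis by (simp add: f_def g_def swap_along_def T2) (simp add: T1)
  qed
  \<comment> \<open>The first exchange moves points by at most \<open>norm v = 3 * R\<close>, the
    second by at most \<open>R + 4 * R\<close>.\<close>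
  moreover have "norm ((g \<circ> f) u - u) \<le> 8 * R" for u
  proof -
    have "norm (f u - u) \<le> 3 * R"
      unfolding f_def using d1 v r
      by (intro norm_swap_along_diff_le) (auto simp: C1_diffeomorphism_def T1)
    moreover have "norm (T2 p - p) \<le> 5 * R" if "p \<in> P'" for p
      using norm_triangle_ineq4[of "T2 p" p] nT2[OF that] nP'(2)[OF that] by linarith
    then have "norm (g (f u) - f u) \<le> 5 * R"
      unfolding g_def using d2 r
      by (intro norm_swap_along_diff_le) (auto simp: C1_diffeomorphism_def)
    ultimately show ?thesis
      using norm_triangle_ineq[of "g (f u) - f u" "f u - u"] by simp
  qed
  ultimately show ?thesis by (rule that)
qed

section \<open>Continuity and the drift condition for the scheme\<close>

lemma continuous_on_F_h:
  assumes "continuous_on UNIV b" "continuous_on UNIV \<sigma>"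
  shows "continuous_on UNIV (F_h h b \<sigma>)"
  unfolding F_h_def case_prod_beta
  by (intro continuous_intros continuous_on_matrix_vector_mult
      continuous_on_compose2[OF assms(1)] continuous_on_compose2[OF assms(2)]) auto

lemma hyp_H1_F_h:
  fixes h C \<alpha> \<beta> :: real
    and b :: "real^'d \<Rightarrow> real^'d"
    and \<sigma> :: "real^'d \<Rightarrow> real^'d^'d"
  assumes C: "C > 0" "\<And>x. norm (b x) \<le> C * (1 + norm x)"
    and \<alpha>: "\<alpha> > 0" "\<And>x. x \<bullet> b x \<le> \<beta> - \<alpha> * (norm x)\<^sup>2"
    and bdd: "bounded (range \<sigma>)"
    and h: "0 < h" "h < min (sqrt (1 + \<alpha> / (2 * C\<^sup>2)) - 1) (1 / \<alpha>)"
  shows "hyp_H1 (F_h h b \<sigma>)"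
proof -
  \<comment> \<open>The coefficient of \<open>(norm x)\<^sup>2\<close> will be
    \<open>1 - 2 * h * \<alpha> + 2 * h\<^sup>2 * C\<^sup>2\<close>, which \<open>hC\<close> bounds
    by \<open>a\<close>. The constants go into \<open>k\<close>, where the absolute value makes
    \<open>0 \<le> k\<close> immediate.\<close>
  define a where "a = 1 - h * \<alpha>"
  define k where "k = 2 * h * \<bar>\<beta>\<bar> + 2 * h\<^sup>2 * C\<^sup>2"
  have h\<alpha>: "0 < h * \<alpha>" "h * \<alpha> < 1"
    using h \<alpha>(1) by (auto simp: field_simps)
  then have a: "0 < a" "a < 1" by (auto simp: a_def)
  have k: "0 \<le> k" using h by (simp add: k_def)
  \<comment> \<open>Square \<open>1 + h < sqrt (1 + \<alpha> / (2 * C\<^sup>2))\<close> and drop the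
    term \<open>h\<^sup>2\<close>.\<close>
  have hC: "2 * h * C\<^sup>2 \<le> \<alpha>"
  proof -
    have "1 + h < sqrt (1 + \<alpha> / (2 * C\<^sup>2))" using h by simp
    then have "(1 + h)\<^sup>2 < 1 + \<alpha> / (2 * C\<^sup>2)"
      using h(1) by (metis add_pos_pos less_eq_real_def real_less_rsqrt real_sqrt_less_iff
          real_sqrt_abs abs_of_pos zero_less_one)
    then have "2 * h + h\<^sup>2 < \<alpha> / (2 * C\<^sup>2)" by (simp add: power2_eq_square algebra_simps)
    then have "2 * h < \<alpha> / (2 * C\<^sup>2)"
      by (smt (verit) zero_le_power2)
    then have "4 * h * C\<^sup>2 < \<alpha>"
      using C(1) by (simp add: field_simps)
    moreover have "0 \<le> h * C\<^sup>2" using h(1) by simp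
    ultimately show ?thesis by linarith
  qed
  have drift: "norm (x + h *\<^sub>R b x) \<le> sqrt a * norm x + sqrt k" for x
  proof -
    have "(norm (b x))\<^sup>2 \<le> (C * (1 + norm x))\<^sup>2"
      using C by (intro power_mono) auto
    \<comment> \<open>The cross term is absorbed by
      \<open>2 * norm x \<le> 1 + (norm x)\<^sup>2\<close>.\<close>
    also have "\<dots> \<le> C\<^sup>2 * (2 + 2 * (norm x)\<^sup>2)"
      using sum_squares_bound[of 1 "norm x"]
      by (auto simp: power_mult_distrib power2_sum intro!: mult_left_mono)
    finally have "h\<^sup>2 * (norm (b x))\<^sup>2 \<le> h\<^sup>2 * (C\<^sup>2 * (2 + 2 * (norm x)\<^sup>2))"
      by (intro mult_left_mono) auto
    moreover have "2 * h * (x \<bullet> b x) \<le> 2 * h * (\<bar>\<beta>\<bar> - \<alpha> * (norm x)\<^sup>2)"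
      using \<alpha>(2)[of x] h(1) by (intro mult_left_mono) auto
    moreover have "(norm (x + h *\<^sub>R b x))\<^sup>2 = (norm x)\<^sup>2 + 2 * h * (x \<bullet> b x) + h\<^sup>2 * (norm (b x))\<^sup>2"
      unfolding power2_norm_eq_inner
      by (simp add: inner_commute power2_eq_square algebra_simps)
    moreover have "h * (norm x)\<^sup>2 * (2 * h * C\<^sup>2) \<le> h * (norm x)\<^sup>2 * \<alpha>"
      using hC h(1) by (intro mult_left_mono) auto
    ultimately have "(norm (x + h *\<^sub>R b x))\<^sup>2 \<le> a * (norm x)\<^sup>2 + k"
      unfolding a_def k_def by (simp add: algebra_simps power2_eq_square)
    then have "norm (x + h *\<^sub>R b x) \<le> sqrt (a * (norm x)\<^sup>2 + k)"
      by (rule real_le_rsqrt)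
    \<comment> \<open>Subadditivity of the square root turns the quadratic estimate into a linear
      one with factor \<open>sqrt a < 1\<close>.\<close>
    also have "\<dots> \<le> sqrt (a * (norm x)\<^sup>2) + sqrt k"
      using a k by (intro sqrt_add_le_add_sqrt) auto
    finally show ?thesis by (simp add: real_sqrt_mult)
  qed
  obtain B where B: "B > 0" "\<And>x. norm (\<sigma> x) \<le> B"
    using bdd by (auto simp: bounded_pos)
  \<comment> \<open>The norm on matrices here is not the operator norm; \<open>M\<close> comes from
    bilinearity.\<close>
  obtain M where M: "M > 0" "\<And>(S::real^'d^'d) (w::real^'d). norm (S *v w) \<le> norm S * norm w * M"
    using bounded_bilinear.pos_bounded[OF bounded_bilinear_matrix_vector_mult] by metis
  have noise: "norm (\<sigma> x *v w) \<le> B * M * norm w" for x w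
  proof -
    have "norm (\<sigma> x) * (norm w * M) \<le> B * (norm w * M)"
      using B M by (intro mult_right_mono) auto
    then show ?thesis using M(2)[of "\<sigma> x" w] by (simp add: algebra_simps)
  qed
  \<comment> \<open>The three summands cover the constant in \<open>V\<close>, the drift remainder
    and the noise.\<close>
  define C' where "C' = 1 + sqrt k + B * M"
  show ?thesis
    unfolding hyp_H1_def
  proof (intro exI conjI allI)
    show "continuous_on UNIV (\<lambda>x :: real^'d. 1 + norm x)"
      by (intro continuous_intros)
    show "filterlim (\<lambda>x :: real^'d. 1 + norm x) at_top at_infinity"
      by (intro filterlim_tendsto_add_at_top[OF tendsto_const] filterlim_norm_at_top)
    show "0 < sqrt a" "sqrt a < 1" using a by auto
    show "C' > 0" using k B M by (simp add: C'_def add_pos_nonneg)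
    show "0 < 1 + norm x" for x :: "real^'d" by (simp add: add_pos_nonneg)
    show "1 + norm (F_h h b \<sigma> (x, w)) \<le> sqrt a * (1 + norm x) + C' * (1 + norm w)" for x w
    proof -
      have "norm (F_h h b \<sigma> (x, w)) \<le> sqrt a * norm x + sqrt k + B * M * norm w"
        using norm_triangle_ineq[of "x + h *\<^sub>R b x" "\<sigma> x *v w"] drift[of x] noise[of x w]
        by (simp add: F_h_def)
      moreover have "0 \<le> sqrt a" "0 \<le> sqrt k * norm w" "0 \<le> B * M"
        using a k B M by auto
      ultimately show ?thesis
        using norm_ge_zero[of w] unfolding C'_def
        by (simp only: distrib_left distrib_right mult_1_left mult_1_right)
    qed
  qed
qed

section \<open>The coupling condition for the scheme\<close>

lemma hyp_H2_F_h:
  fixes h :: real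
    and b :: "real^'d \<Rightarrow> real^'d"
    and \<sigma> :: "real^'d \<Rightarrow> real^'d^'d"
  assumes b: "continuous_on UNIV b" and \<sigma>: "continuous_on UNIV \<sigma>"
    and inv: "\<And>x. invertible (\<sigma> x)"
    and \<sigma>': "continuous_on UNIV (\<lambda>x. matrix_inv (\<sigma> x))"
  shows "hyp_H2 (F_h h b \<sigma>)"
  unfolding hyp_H2_def
proof (intro allI impI)
  fix K :: real assume K: "K > 0"
  let ?B = "cball (0 :: real^'d) K"
  \<comment> \<open>Solving
    \<open>F_h h b \<sigma> (x, u + y) = F_h h b \<sigma> (x', w + y')\<close> for \<open>w\<close>
    gives \<open>A x x' *v u + c x x' y y'\<close>.\<close>
  define A where "A x x' = matrix_inv (\<sigma> x') ** \<sigma> x" for x x'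
  define c where "c x x' y y' =
    matrix_inv (\<sigma> x') *v (x + h *\<^sub>R b x - x' - h *\<^sub>R b x' + \<sigma> x *v y) - y'" for x x' y y'
  note cont = continuous_intros continuous_on_matrix_vector_mult continuous_on_matrix_matrix_mult
    continuous_on_det continuous_on_compose2[OF b] continuous_on_compose2[OF \<sigma>]
    continuous_on_compose2[OF \<sigma>']
  have invA: "invertible (A x x')" for x x'
    unfolding A_def using inv by (intro invertible_mult matrix_inv_cancel)
  \<comment> \<open>This function is continuous and nowhere zero, so its minimum over the compact
    product is a positive lower bound.\<close>
  let ?d = "\<lambda>p. \<bar>det (A (fst p) (snd p))\<bar>"
  have "continuous_on (?B \<times> ?B) ?d"
    unfolding A_def by (intro cont) auto
  moreover have "compact (?B \<times> ?B)" "?B \<times> ?B \<noteq> {}"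
    using K by (auto intro: compact_Times)
  ultimately obtain z where z: "\<forall>p\<in>?B \<times> ?B. ?d z \<le> ?d p"
    using continuous_attains_inf[of "?B \<times> ?B" ?d] by blast
  define CK where "CK = ?d z"
  have CK: "CK > 0" using invA[of "fst z" "snd z"] by (simp add: CK_def invertible_det_nz)
  have min: "CK \<le> \<bar>det (A x x')\<bar>" if "x \<in> ?B" "x' \<in> ?B" for x x'
    using bspec[OF z, of "(x, x')"] that by (simp add: CK_def)
  let ?S = "?B \<times> ?B \<times> ?B \<times> ?B \<times> cball (0 :: real^'d) 2"
  let ?G = "\<lambda>(x, x', y, y', u). A x x' *v u + c x x' y y'"
  have "compact (?G ` ?S)"
    unfolding A_def c_def case_prod_beta
    by (intro compact_continuous_image compact_Times compact_cball cont) auto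
  then have "bounded (?G ` ?S)" by (rule compact_imp_bounded)
  then obtain R0 where R0: "\<forall>q\<in>?G ` ?S. norm q \<le> R0"
    unfolding bounded_iff by (rule exE)
  \<comment> \<open>The maximum secures \<open>r \<le> R\<close> with \<open>r = 2\<close> in the
    extension lemma.\<close>
  define R where "R = max 2 R0"
  have R2: "2 \<le> R" by (simp add: R_def)
  have R: "norm (A x x' *v u + c x x' y y') \<le> R"
    if "x \<in> ?B" "x' \<in> ?B" "y \<in> ?B" "y' \<in> ?B" "u \<in> ball 0 2" for x x' y y' u
  proof -
    have "norm (?G (x, x', y, y', u)) \<le> R0"
      by (rule bspec[OF R0], rule imageI) (use that in auto)
    then show ?thesis by (simp add: R_def)
  qed
  show "\<exists>Kt>0. \<exists>CK>0. \<exists>MK>0. \<forall>x\<in>?B. \<forall>x'\<in>?B. \<forall>y\<in>?B. \<forall>y'\<in>?B.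
    \<exists>\<Lambda>. bij \<Lambda> \<and> (\<exists>U D. C1_diffeomorphism U D \<Lambda> \<and> negligible (- U) \<and> negligible (- D)) \<and>
      (\<forall>u\<in>cball 0 Kt. tilde (F_h h b \<sigma>) x u y = tilde (F_h h b \<sigma>) x' (\<Lambda> u) y' \<and>
         \<Lambda> differentiable (at u) \<and> \<bar>det (jacobian \<Lambda> (at u))\<bar> \<ge> CK) \<and>
      (\<forall>u. norm (\<Lambda> u - u) \<le> MK)"
  \<comment> \<open>Radius 1 lies strictly inside radius 2, so around each point of the closed unit
    ball \<Lambda> is affine on an open neighbourhood and its Jacobian is
    \<open>A x x'\<close>.\<close>
  proof (rule exI[of _ 1], rule conjI[OF zero_less_one], rule exI[of _ CK], rule conjI[OF CK],
      rule exI[of _ "8 * R"], intro conjI ballI)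
    fix x x' y y' assume x: "x \<in> ?B" "x' \<in> ?B" "y \<in> ?B" "y' \<in> ?B"
    obtain \<Lambda> where L: "almost_C1_diffeomorphism \<Lambda>"
      "\<And>u. u \<in> ball 0 2 \<Longrightarrow> \<Lambda> u = A x x' *v u + c x x' y y'"
      "\<And>u. norm (\<Lambda> u - u) \<le> 8 * R"
      using affine_extension_almost_C1_diffeomorphism[OF invA zero_less_numeral R2 R[OF x]]
      by blast
    show "\<exists>\<Lambda>. bij \<Lambda> \<and> (\<exists>U D. C1_diffeomorphism U D \<Lambda> \<and> negligible (- U) \<and> negligible (- D)) \<and>
      (\<forall>u\<in>cball 0 1. tilde (F_h h b \<sigma>) x u y = tilde (F_h h b \<sigma>) x' (\<Lambda> u) y' \<and>
         \<Lambda> differentiable (at u) \<and> \<bar>det (jacobian \<Lambda> (at u))\<bar> \<ge> CK) \<and>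
      (\<forall>u. norm (\<Lambda> u - u) \<le> 8 * R)"
    proof (intro exI[of _ \<Lambda>] conjI ballI allI)
      fix u :: "real^'d" assume "u \<in> cball 0 1"
      then have u: "u \<in> ball 0 2" by auto
      have "\<sigma> x' *v (\<Lambda> u + y') =
          \<sigma> x *v u + (x + h *\<^sub>R b x - x' - h *\<^sub>R b x' + \<sigma> x *v y)"
        unfolding L(2)[OF u] A_def c_def
        by (simp add: matrix_vector_right_distrib matrix_inv_cancel inv
            flip: matrix_vector_mul_assoc)
      then show "tilde (F_h h b \<sigma>) x u y = tilde (F_h h b \<sigma>) x' (\<Lambda> u) y'"
        unfolding tilde_def F_h_def
        by (simp add: matrix_vector_right_distrib algebra_simps)
      have D: "(\<Lambda> has_derivative (\<lambda>h. A x x' *v h)) (at u)"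
        by (rule has_derivative_transform_within_open[OF has_derivative_affine open_ball u])
          (simp add: L(2))
      then show "\<Lambda> differentiable (at u)" by (auto simp: differentiable_def)
      show "\<bar>det (jacobian \<Lambda> (at u))\<bar> \<ge> CK"
        using min[OF x(1,2)] by (simp add: jacobian_eq[OF D])
    qed (use L in \<open>auto simp: almost_C1_diffeomorphism_def\<close>)
  qed (use R2 in auto)
qed

text \<open>Continuity of \<open>F_h h b \<sigma>\<close> belongs to the conclusion because both
  hypotheses are formulated for continuous maps.\<close>

theorem theorem2p2:
  fixes h C \<alpha> \<beta> :: real
    and b :: "real^'d \<Rightarrow> real^'d"
    and \<sigma> :: "real^'d \<Rightarrow> real^'d^'d"
  assumes "continuous_on UNIV b"
    and "C > 0" and "\<And>x. norm (b x) \<le> C * (1 + norm x)"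
    and "\<alpha> > 0" and "\<And>x. x \<bullet> b x \<le> \<beta> - \<alpha> * (norm x)\<^sup>2"
    and "continuous_on UNIV \<sigma>" and "bounded (range \<sigma>)"
    and "\<And>x. invertible (\<sigma> x)"
    and "continuous_on UNIV (\<lambda>x. matrix_inv (\<sigma> x))"
    and "0 < h" and "h < min (sqrt (1 + \<alpha> / (2 * C\<^sup>2)) - 1) (1 / \<alpha>)"
  shows "continuous_on UNIV (F_h h b \<sigma>) \<and> hyp_H1 (F_h h b \<sigma>) \<and> hyp_H2 (F_h h b \<sigma>)"
  using assms by (intro conjI continuous_on_F_h hyp_H1_F_h[of C b \<alpha> \<beta>] hyp_H2_F_h) auto

end
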